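(* Let $\mathcal X$ be cowellpowered with products and suppose that every morphism of $\mathcal X$ can be factored as an epimorphism followed by a monomorphism. Let $\mathcal A$ be a reflective subcategory of $\mathcal X$ and let $\mathcal B$ be the subcategory of $\mathcal X$ whose objects are the $\mathcal X$-subobjects of $\mathcal A$-objects (i.e. the objects $X$ admitting a monomorphism $X\to A$ in $\mathcal X$ with $A\in\mathcal A$). Then $\mathcal A$ and $\mathcal B$ induce the same regular closure operators (up to isomorphism), i.e. $c_{\mathcal A}(m)\cong c_{\mathcal B}(m)$ for all $m\in\mathcal M$.
   Context: Subcategories are always full and isomorphism-closed. $\mathcal X$ is a category with a fixed class $\mathcal M$ of morphisms containing all isomorphisms. $\mathcal X$ is $\mathcal M$-complete: $\mathcal M$ is closed under composition; pullbacks of $\mathcal M$-morphisms exist and belong to $\mathcal M$; multiple pullbacks of (possibly large) families of $\mathcal M$-morphisms with common codomain exist and belong to $\mathcal M$. Consequently every morphism in $\mathcal M$ is a monomorphism, and for each object $X$ the class $\mathcal M/X$ of $\mathcal M$-morphisms with codomain $X$ is a (possibly large) complete preordered class ($m\le n$ iff $m = n\cdot k$ for some $k$); $\cong$ denotes equivalence in this preorder. Moreover $\mathcal X$ has equalizers and cokernel pairs, and $\mathcal M$ contains all regular monomorphisms of $\mathcal X$. For a subcategory $\mathcal A$, a morphism is an $\mathcal A$-regular monomorphism if it is the equalizer of two morphisms $h,k : Y\to A$ with $A\in\mathcal A$. The regular closure operator induced by $\mathcal A$ is $c_{\mathcal A}(m)=\bigwedge\{r\in\mathcal M \mid r\ge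 m,\ r \text{ is } \mathcal A\text{-regular}\}$ for $m \in \mathcal M/X$ (meet in $\mathcal M/X$). A category is cowellpowered if each object admits only a (small) set of non-equivalent epimorphisms with that object as domain. *)

theory Defs
  imports Main "HOL-Library.Equipollence"
begin

text \<open>
  Size conventions. One type \<open>'u\<close> stands for the universe of all sets: a class is an arbitrary
  subset of \<open>'u\<close>, and a class is small when it has strictly fewer elements than \<open>'u\<close>. If \<open>'u\<close> has
  inaccessible cardinality, these are exactly the classes and the small classes of a Grothendieck
  universe, whose members are its subsets of smaller cardinality. Uncountability of the universe
  is not required.
\<close>

definition small :: "'u set \<Rightarrow> bool" where
  "small S \<longleftrightarrow> S \<prec> (UNIV :: 'u set)"

definition set_universe :: "'u itself \<Rightarrow> bool" where
  "set_universe _ \<longleftrightarrow>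
     infinite (UNIV :: 'u set) \<and>
     (\<forall>S :: 'u set. small S \<longrightarrow> Pow S \<prec> (UNIV :: 'u set)) \<and>
     (\<forall>(I :: 'u set) (F :: 'u \<Rightarrow> 'u set). small I \<longrightarrow> (\<forall>i\<in>I. small (F i)) \<longrightarrow> small (\<Union>i\<in>I. F i))"

text \<open>The operations of the record are only meaningful on objects, arrows and composable pairs.\<close>

record 'u cat =
  Obj :: "'u set"
  Arr :: "'u set"
  Dom :: "'u \<Rightarrow> 'u"
  Cod :: "'u \<Rightarrow> 'u"
  Ident :: "'u \<Rightarrow> 'u"
  Comp :: "'u \<Rightarrow> 'u \<Rightarrow> 'u" (infixl "\<cdot>\<index>" 70)

definition hom :: "'u cat \<Rightarrow> 'u \<Rightarrow> 'u \<Rightarrow> 'u set" where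
  "hom C X Y = {f \<in> Arr C. Dom C f = X \<and> Cod C f = Y}"

locale category =
  fixes C :: "'u cat" (structure)
  assumes Dom_obj: "f \<in> Arr C \<Longrightarrow> Dom C f \<in> Obj C"
    and Cod_obj: "f \<in> Arr C \<Longrightarrow> Cod C f \<in> Obj C"
    and Ident_hom: "X \<in> Obj C \<Longrightarrow> Ident C X \<in> hom C X X"
    and Comp_hom: "f \<in> hom C X Y \<Longrightarrow> g \<in> hom C Y Z \<Longrightarrow> g \<cdot> f \<in> hom C X Z"
    and Comp_Ident: "f \<in> hom C X Y \<Longrightarrow> f \<cdot> Ident C X = f"
    and Ident_Comp: "f \<in> hom C X Y \<Longrightarrow> Ident C Y \<cdot> f = f"
    and Comp_assoc: "f \<in> hom C W X \<Longrightarrow> g \<in> hom C X Y \<Longrightarrow> h \<in> hom C Y Z \<Longrightarrow>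
                       (h \<cdot> g) \<cdot> f = h \<cdot> (g \<cdot> f)"
    and hom_small: "X \<in> Obj C \<Longrightarrow> Y \<in> Obj C \<Longrightarrow> small (hom C X Y)"

definition isomorphism :: "'u cat \<Rightarrow> 'u \<Rightarrow> bool" where
  "isomorphism C f \<longleftrightarrow> f \<in> Arr C \<and>
     (\<exists>g\<in>hom C (Cod C f) (Dom C f).
        g \<cdot>\<^bsub>C\<^esub> f = Ident C (Dom C f) \<and> f \<cdot>\<^bsub>C\<^esub> g = Ident C (Cod C f))"

definition monomorphism :: "'u cat \<Rightarrow> 'u \<Rightarrow> bool" where
  "monomorphism C m \<longleftrightarrow> m \<in> Arr C \<and>
     (\<forall>W. \<forall>f\<in>hom C W (Dom C m). \<forall>g\<in>hom C W (Dom C m). m \<cdot>\<^bsub>C\<^esub> f = m \<cdot>\<^bsub>C\<^esub> g \<longrightarrow> f = g)"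

definition epimorphism :: "'u cat \<Rightarrow> 'u \<Rightarrow> bool" where
  "epimorphism C e \<longleftrightarrow> e \<in> Arr C \<and>
     (\<forall>Z. \<forall>f\<in>hom C (Cod C e) Z. \<forall>g\<in>hom C (Cod C e) Z. f \<cdot>\<^bsub>C\<^esub> e = g \<cdot>\<^bsub>C\<^esub> e \<longrightarrow> f = g)"

definition equalizer :: "'u cat \<Rightarrow> 'u \<Rightarrow> 'u \<Rightarrow> 'u \<Rightarrow> bool" where
  "equalizer C h k e \<longleftrightarrow>
     (\<exists>E Y Z. h \<in> hom C Y Z \<and> k \<in> hom C Y Z \<and> e \<in> hom C E Y \<and> h \<cdot>\<^bsub>C\<^esub> e = k \<cdot>\<^bsub>C\<^esub> e \<and>
        (\<forall>W. \<forall>f\<in>hom C W Y. h \<cdot>\<^bsub>C\<^esub> f = k \<cdot>\<^bsub>C\<^esub> f \<longrightarrow> (\<exists>!u. u \<in> hom C W E \<and> e \<cdot>\<^bsub>C\<^esub> u = f)))"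

definition has_equalizers :: "'u cat \<Rightarrow> bool" where
  "has_equalizers C \<longleftrightarrow>
     (\<forall>Y Z. \<forall>h\<in>hom C Y Z. \<forall>k\<in>hom C Y Z. \<exists>e. equalizer C h k e)"

definition cokernel_pair :: "'u cat \<Rightarrow> 'u \<Rightarrow> 'u \<Rightarrow> 'u \<Rightarrow> bool" where
  "cokernel_pair C f i j \<longleftrightarrow>
     (\<exists>X Y Z. f \<in> hom C X Y \<and> i \<in> hom C Y Z \<and> j \<in> hom C Y Z \<and> i \<cdot>\<^bsub>C\<^esub> f = j \<cdot>\<^bsub>C\<^esub> f \<and>
        (\<forall>W. \<forall>a\<in>hom C Y W. \<forall>b\<in>hom C Y W. a \<cdot>\<^bsub>C\<^esub> f = b \<cdot>\<^bsub>C\<^esub> f \<longrightarrow>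
           (\<exists>!u. u \<in> hom C Z W \<and> u \<cdot>\<^bsub>C\<^esub> i = a \<and> u \<cdot>\<^bsub>C\<^esub> j = b)))"

definition has_cokernel_pairs :: "'u cat \<Rightarrow> bool" where
  "has_cokernel_pairs C \<longleftrightarrow> (\<forall>f\<in>Arr C. \<exists>i j. cokernel_pair C f i j)"

text \<open>\<open>pullback C m f p q\<close>: in the square \<open>m \<cdot> q = f \<cdot> p\<close>, the arrow \<open>p\<close> is the pullback of \<open>m\<close>
  along \<open>f\<close>.\<close>

definition pullback :: "'u cat \<Rightarrow> 'u \<Rightarrow> 'u \<Rightarrow> 'u \<Rightarrow> 'u \<Rightarrow> bool" where
  "pullback C m f p q \<longleftrightarrow>
     (\<exists>P N X Y. m \<in> hom C N Y \<and> f \<in> hom C X Y \<and> p \<in> hom C P X \<and> q \<in> hom C P N \<and>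
        m \<cdot>\<^bsub>C\<^esub> q = f \<cdot>\<^bsub>C\<^esub> p \<and>
        (\<forall>W. \<forall>a\<in>hom C W X. \<forall>b\<in>hom C W N. m \<cdot>\<^bsub>C\<^esub> b = f \<cdot>\<^bsub>C\<^esub> a \<longrightarrow>
           (\<exists>!u. u \<in> hom C W P \<and> p \<cdot>\<^bsub>C\<^esub> u = a \<and> q \<cdot>\<^bsub>C\<^esub> u = b)))"

text \<open>\<open>d\<close> is the diagonal of the multiple pullback, with projections \<open>p i\<close>, of the family
  \<open>(m i)\<^sub>i\<close> of arrows with codomain \<open>X\<close>. For \<open>I = {}\<close> the diagonal is an isomorphism onto \<open>X\<close>.\<close>

definition multiple_pullback ::
  "'u cat \<Rightarrow> 'u \<Rightarrow> 'u set \<Rightarrow> ('u \<Rightarrow> 'u) \<Rightarrow> 'u \<Rightarrow> ('u \<Rightarrow> 'u) \<Rightarrow> bool" where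
  "multiple_pullback C X I m d p \<longleftrightarrow>
     (\<exists>P. d \<in> hom C P X \<and>
        (\<forall>i\<in>I. p i \<in> hom C P (Dom C (m i)) \<and> m i \<cdot>\<^bsub>C\<^esub> p i = d) \<and>
        (\<forall>W. \<forall>a\<in>hom C W X. \<forall>b. (\<forall>i\<in>I. b i \<in> hom C W (Dom C (m i)) \<and> m i \<cdot>\<^bsub>C\<^esub> b i = a) \<longrightarrow>
           (\<exists>!u. u \<in> hom C W P \<and> d \<cdot>\<^bsub>C\<^esub> u = a \<and> (\<forall>i\<in>I. p i \<cdot>\<^bsub>C\<^esub> u = b i))))"

definition is_product :: "'u cat \<Rightarrow> 'u set \<Rightarrow> ('u \<Rightarrow> 'u) \<Rightarrow> 'u \<Rightarrow> ('u \<Rightarrow> 'u) \<Rightarrow> bool" where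
  "is_product C I F P p \<longleftrightarrow>
     P \<in> Obj C \<and> (\<forall>i\<in>I. p i \<in> hom C P (F i)) \<and>
     (\<forall>W\<in>Obj C. \<forall>b. (\<forall>i\<in>I. b i \<in> hom C W (F i)) \<longrightarrow>
        (\<exists>!u. u \<in> hom C W P \<and> (\<forall>i\<in>I. p i \<cdot>\<^bsub>C\<^esub> u = b i)))"

definition has_products :: "'u cat \<Rightarrow> bool" where
  "has_products C \<longleftrightarrow>
     (\<forall>I F. small I \<longrightarrow> (\<forall>i\<in>I. F i \<in> Obj C) \<longrightarrow> (\<exists>P p. is_product C I F P p))"

definition equivalent_epis :: "'u cat \<Rightarrow> 'u \<Rightarrow> 'u \<Rightarrow> bool" where
  "equivalent_epis C e e' \<longleftrightarrow>
     (\<exists>u\<in>hom C (Cod C e) (Cod C e'). isomorphism C u \<and> u \<cdot>\<^bsub>C\<^esub> e = e')"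

definition cowellpowered :: "'u cat \<Rightarrow> bool" where
  "cowellpowered C \<longleftrightarrow>
     (\<forall>X\<in>Obj C. \<exists>R. small R \<and> (\<forall>e\<in>R. epimorphism C e \<and> Dom C e = X) \<and>
        (\<forall>e. epimorphism C e \<and> Dom C e = X \<longrightarrow> (\<exists>e'\<in>R. equivalent_epis C e e')))"

definition has_epi_mono_factorizations :: "'u cat \<Rightarrow> bool" where
  "has_epi_mono_factorizations C \<longleftrightarrow>
     (\<forall>f\<in>Arr C. \<exists>e m. epimorphism C e \<and> monomorphism C m \<and> Cod C e = Dom C m \<and> f = m \<cdot>\<^bsub>C\<^esub> e)"

text \<open>Subcategories are full and isomorphism-closed, hence given by their class of objects.\<close>

definition subcategory :: "'u cat \<Rightarrow> 'u set \<Rightarrow> bool" where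
  "subcategory C \<A> \<longleftrightarrow> \<A> \<subseteq> Obj C \<and>
     (\<forall>f. isomorphism C f \<and> Dom C f \<in> \<A> \<longrightarrow> Cod C f \<in> \<A>)"

definition reflective :: "'u cat \<Rightarrow> 'u set \<Rightarrow> bool" where
  "reflective C \<A> \<longleftrightarrow> subcategory C \<A> \<and>
     (\<forall>X\<in>Obj C. \<exists>A\<in>\<A>. \<exists>r\<in>hom C X A.
        \<forall>A'\<in>\<A>. \<forall>f\<in>hom C X A'. \<exists>!g. g \<in> hom C A A' \<and> g \<cdot>\<^bsub>C\<^esub> r = f)"

definition subobjects_of :: "'u cat \<Rightarrow> 'u set \<Rightarrow> 'u set" where
  "subobjects_of C \<A> = {X \<in> Obj C. \<exists>A\<in>\<A>. \<exists>m\<in>hom C X A. monomorphism C m}"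

definition regular_mono :: "'u cat \<Rightarrow> 'u set \<Rightarrow> 'u \<Rightarrow> bool" where
  "regular_mono C \<A> r \<longleftrightarrow>
     (\<exists>Y. \<exists>A\<in>\<A>. \<exists>h\<in>hom C Y A. \<exists>k\<in>hom C Y A. equalizer C h k r)"

text \<open>
  Multiple pullbacks are required for all indexed families of \<open>\<M>\<close>-morphisms, repetitions
  and index classes of any size included. Plain regular monomorphisms are those relative to the
  class of all objects.
\<close>

locale M_complete_category = category C for C :: "'u cat" (structure) +
  fixes \<M> :: "'u set"
  assumes M_arr: "\<M> \<subseteq> Arr C"
    and iso_M: "isomorphism C f \<Longrightarrow> f \<in> \<M>"
    and Comp_M: "m \<in> \<M> \<Longrightarrow> n \<in> \<M> \<Longrightarrow> Cod C m = Dom C n \<Longrightarrow> n \<cdot> m \<in> \<M>"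
    and pullback_ex: "m \<in> \<M> \<Longrightarrow> f \<in> Arr C \<Longrightarrow> Cod C f = Cod C m \<Longrightarrow> \<exists>p q. pullback C m f p q"
    and pullback_M: "m \<in> \<M> \<Longrightarrow> pullback C m f p q \<Longrightarrow> p \<in> \<M>"
    and multiple_pullback_ex:
      "X \<in> Obj C \<Longrightarrow> (\<And>i. i \<in> I \<Longrightarrow> F i \<in> \<M> \<and> Cod C (F i) = X) \<Longrightarrow>
         \<exists>d \<pi>. multiple_pullback C X I F d \<pi>"
    and multiple_pullback_M:
      "X \<in> Obj C \<Longrightarrow> (\<And>i. i \<in> I \<Longrightarrow> F i \<in> \<M> \<and> Cod C (F i) = X) \<Longrightarrow>
         multiple_pullback C X I F d \<pi> \<Longrightarrow> d \<in> \<M>"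

locale regular_closure_setting = M_complete_category C \<M>
  for C :: "'u cat" (structure) and \<M> :: "'u set" +
  assumes equalizers: "has_equalizers C"
    and cokernel_pairs: "has_cokernel_pairs C"
    and regular_mono_M: "regular_mono C (Obj C) r \<Longrightarrow> r \<in> \<M>"

definition M_over :: "'u cat \<Rightarrow> 'u set \<Rightarrow> 'u \<Rightarrow> 'u set" where
  "M_over C \<M> X = {m \<in> \<M>. Cod C m = X}"

definition M_le :: "'u cat \<Rightarrow> 'u set \<Rightarrow> 'u \<Rightarrow> 'u \<Rightarrow> 'u \<Rightarrow> bool" where
  "M_le C \<M> X m n \<longleftrightarrow> m \<in> M_over C \<M> X \<and> n \<in> M_over C \<M> X \<and>
     (\<exists>k\<in>hom C (Dom C m) (Dom C n). m = n \<cdot>\<^bsub>C\<^esub> k)"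

definition M_equiv :: "'u cat \<Rightarrow> 'u set \<Rightarrow> 'u \<Rightarrow> 'u \<Rightarrow> 'u \<Rightarrow> bool" where
  "M_equiv C \<M> X m n \<longleftrightarrow> M_le C \<M> X m n \<and> M_le C \<M> X n m"

definition M_meet :: "'u cat \<Rightarrow> 'u set \<Rightarrow> 'u \<Rightarrow> 'u set \<Rightarrow> 'u \<Rightarrow> bool" where
  "M_meet C \<M> X S d \<longleftrightarrow> d \<in> M_over C \<M> X \<and> (\<forall>r\<in>S. M_le C \<M> X d r) \<and>
     (\<forall>n\<in>M_over C \<M> X. (\<forall>r\<in>S. M_le C \<M> X n r) \<longrightarrow> M_le C \<M> X n d)"

definition regular_above :: "'u cat \<Rightarrow> 'u set \<Rightarrow> 'u set \<Rightarrow> 'u \<Rightarrow> 'u set" where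
  "regular_above C \<M> \<A> m = {r \<in> \<M>. M_le C \<M> (Cod C m) m r \<and> regular_mono C \<A> r}"

text \<open>Meets in the preordered class of \<open>\<M>\<close>-morphisms into an object are only determined up to
  equivalence, so a value is chosen; \<open>regular_closure_meet\<close> below shows that there is one.\<close>

definition regular_closure :: "'u cat \<Rightarrow> 'u set \<Rightarrow> 'u set \<Rightarrow> 'u \<Rightarrow> 'u" where
  "regular_closure C \<M> \<A> m = (SOME c. M_meet C \<M> (Cod C m) (regular_above C \<M> \<A> m) c)"

lemma (in M_complete_category) M_meet_ex:
  assumes X: "X \<in> Obj C" and S: "S \<subseteq> M_over C \<M> X"
  shows "\<exists>d. M_meet C \<M> X S d"
proof -
  have fam: "\<And>i. i \<in> S \<Longrightarrow> i \<in> \<M> \<and> Cod C i = X"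
    using S by (auto simp: M_over_def)
  obtain d p where mp: "multiple_pullback C X S (\<lambda>i. i) d p"
    using multiple_pullback_ex[OF X, of S "\<lambda>i. i"] fam by blast
  have d: "d \<in> \<M>"
    using multiple_pullback_M[OF X, of S "\<lambda>i. i"] fam mp by blast
  obtain P where dP: "d \<in> hom C P X"
    and pr: "\<forall>i\<in>S. p i \<in> hom C P (Dom C i) \<and> i \<cdot> p i = d"
    and univ: "\<forall>W. \<forall>a\<in>hom C W X. \<forall>b. (\<forall>i\<in>S. b i \<in> hom C W (Dom C i) \<and> i \<cdot> b i = a) \<longrightarrow>
        (\<exists>!u. u \<in> hom C W P \<and> d \<cdot> u = a \<and> (\<forall>i\<in>S. p i \<cdot> u = b i))"
    using mp unfolding multiple_pullback_def by (elim exE conjE) (rule that)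
  have dX: "d \<in> M_over C \<M> X" and DomD: "Dom C d = P"
    using d dP by (auto simp: M_over_def hom_def)
  have "M_le C \<M> X n d" if n: "n \<in> M_over C \<M> X" and lb: "\<forall>r\<in>S. M_le C \<M> X n r" for n
  proof -
    have "\<forall>r\<in>S. \<exists>k. k \<in> hom C (Dom C n) (Dom C r) \<and> r \<cdot> k = n"
      using lb unfolding M_le_def by fastforce
    from bchoice[OF this] obtain b
      where b: "\<forall>r\<in>S. b r \<in> hom C (Dom C n) (Dom C r) \<and> r \<cdot> b r = n"
      by blast
    have "n \<in> hom C (Dom C n) X"
      using n M_arr by (auto simp: M_over_def hom_def)
    from univ[rule_format, OF this, of b] b obtain u
      where "u \<in> hom C (Dom C n) P" "d \<cdot> u = n"
      by (auto dest: ex1_implies_ex)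
    then show ?thesis
      using n dX DomD by (auto simp: M_le_def)
  qed
  moreover have "M_le C \<M> X d r" if "r \<in> S" for r
    proof -
    have "p r \<in> hom C (Dom C d) (Dom C r)" "d = r \<cdot> p r"
      using pr that DomD by simp_all
    then show ?thesis
      unfolding M_le_def using that dX S by blast
  qed
  ultimately show ?thesis
    using dX by (auto simp: M_meet_def)
qed

lemma (in M_complete_category) regular_closure_meet:
  assumes "m \<in> \<M>"
  shows "M_meet C \<M> (Cod C m) (regular_above C \<M> \<A> m) (regular_closure C \<M> \<A> m)"
proof -
  have "Cod C m \<in> Obj C"
    using assms M_arr Cod_obj by blast
  moreover have "regular_above C \<M> \<A> m \<subseteq> M_over C \<M> (Cod C m)"
    by (auto simp: regular_above_def M_le_def)
  ultimately show ?thesis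
    unfolding regular_closure_def by (rule someI_ex[OF M_meet_ex])
qed

end

theory Submission
  imports Defs
begin

text \<open>
  Composing a parallel pair with a monomorphism does not change which arrows equalize it. So if
  \<open>r\<close> is the equalizer of \<open>h, k : Y \<rightarrow> B\<close> and \<open>n : B \<rightarrow> A\<close> is a monomorphism into an object of
  \<open>\<A>\<close>, then \<open>r\<close> is also the equalizer of \<open>n \<cdot> h, n \<cdot> k : Y \<rightarrow> A\<close>. Hence the subobjects of
  \<open>\<A>\<close>-objects define no regular monomorphisms beyond the \<open>\<A>\<close>-regular ones. Conversely every
  \<open>\<A>\<close>-object is a subobject of itself. The two closures of \<open>m\<close> are therefore meets of one and
  the same class of \<open>\<M>\<close>-morphisms.
\<close>

lemma (in category) equalizer_mono_comp:
  assumes eq: "equalizer C h k r"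
    and h: "h \<in> hom C Y B" and k: "k \<in> hom C Y B"
    and n: "n \<in> hom C B A" and mono: "monomorphism C n"
  shows "equalizer C (n \<cdot> h) (n \<cdot> k) r"
proof -
  obtain E where r: "r \<in> hom C E Y" "h \<cdot> r = k \<cdot> r"
    and univ: "\<And>W f. f \<in> hom C W Y \<Longrightarrow> h \<cdot> f = k \<cdot> f \<Longrightarrow> \<exists>!u. u \<in> hom C W E \<and> r \<cdot> u = f"
    using eq h k unfolding equalizer_def hom_def by auto
  have cancel: "(n \<cdot> h) \<cdot> f = (n \<cdot> k) \<cdot> f \<longleftrightarrow> h \<cdot> f = k \<cdot> f" if f: "f \<in> hom C W Y" for W f
  proof -
    have "h \<cdot> f \<in> hom C W (Dom C n)" "k \<cdot> f \<in> hom C W (Dom C n)"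
      using Comp_hom[OF f h] Comp_hom[OF f k] n by (auto simp: hom_def)
    then have "n \<cdot> (h \<cdot> f) = n \<cdot> (k \<cdot> f) \<longleftrightarrow> h \<cdot> f = k \<cdot> f"
      using mono unfolding monomorphism_def by metis
    then show ?thesis
      by (simp add: Comp_assoc[OF f h n] Comp_assoc[OF f k n])
  qed
  show ?thesis
    unfolding equalizer_def
  proof (intro exI conjI allI ballI impI)
    show "n \<cdot> h \<in> hom C Y A" "n \<cdot> k \<in> hom C Y A"
      using h k n by (auto intro: Comp_hom)
    show "r \<in> hom C E Y" "(n \<cdot> h) \<cdot> r = (n \<cdot> k) \<cdot> r"
      using r cancel by auto
    show "\<exists>!u. u \<in> hom C W E \<and> r \<cdot> u = f"
      if "f \<in> hom C W Y" "(n \<cdot> h) \<cdot> f = (n \<cdot> k) \<cdot> f" for W f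
      using that univ cancel by blast
  qed
qed

lemma (in category) monomorphism_Ident:
  assumes "X \<in> Obj C"
  shows "monomorphism C (Ident C X)"
proof -
  have "Ident C X \<in> Arr C" "Dom C (Ident C X) = X"
    using Ident_hom[OF assms] by (auto simp: hom_def)
  then show ?thesis
    by (auto simp: monomorphism_def Ident_Comp)
qed

lemma (in category) subset_subobjects_of:
  assumes "\<A> \<subseteq> Obj C"
  shows "\<A> \<subseteq> subobjects_of C \<A>"
  unfolding subobjects_of_def
  using assms Ident_hom monomorphism_Ident by blast

lemma (in category) regular_mono_subobjects_of:
  assumes "\<A> \<subseteq> Obj C"
  shows "regular_mono C (subobjects_of C \<A>) r \<longleftrightarrow> regular_mono C \<A> r"
proof
  assume "regular_mono C (subobjects_of C \<A>) r"
  then obtain Y B h k A n where hk: "h \<in> hom C Y B" "k \<in> hom C Y B" "equalizer C h k r"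
    and n: "A \<in> \<A>" "n \<in> hom C B A" "monomorphism C n"
    unfolding regular_mono_def subobjects_of_def by blast
  have "equalizer C (n \<cdot> h) (n \<cdot> k) r"
    using hk n by (blast intro: equalizer_mono_comp)
  moreover have "n \<cdot> h \<in> hom C Y A" "n \<cdot> k \<in> hom C Y A"
    using hk n by (auto intro: Comp_hom)
  ultimately show "regular_mono C \<A> r"
    using n(1) unfolding regular_mono_def by blast
next
  assume "regular_mono C \<A> r"
  then show "regular_mono C (subobjects_of C \<A>) r"
    using subset_subobjects_of[OF assms] unfolding regular_mono_def by blast
qed

lemma (in category) M_le_refl:
  assumes "m \<in> M_over C \<M> X" and "m \<in> Arr C"
  shows "M_le C \<M> X m m"
proof -
  have "Ident C (Dom C m) \<in> hom C (Dom C m) (Dom C m)" "m = m \<cdot> Ident C (Dom C m)"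
    using assms(2) Ident_hom Dom_obj Comp_Ident by (auto simp: hom_def)
  then show ?thesis
    using assms(1) by (auto simp: M_le_def)
qed

theorem theorem3p2:
  fixes C :: "'u cat" and \<M> :: "'u set" and \<A> :: "'u set" and \<B> :: "'u set"
  assumes "set_universe TYPE('u)"
    and "regular_closure_setting C \<M>"
    and "cowellpowered C"
    and "has_products C"
    and "has_epi_mono_factorizations C"
    and "reflective C \<A>"
    and "\<B> = subobjects_of C \<A>"
  shows "\<forall>m\<in>\<M>. M_equiv C \<M> (Cod C m) (regular_closure C \<M> \<A> m) (regular_closure C \<M> \<B> m)"
proof
  fix m assume m: "m \<in> \<M>"
  interpret regular_closure_setting C \<M> by fact
  have "\<A> \<subseteq> Obj C"
    using assms(6) by (simp add: reflective_def subcategory_def)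
  then have "regular_above C \<M> \<B> m = regular_above C \<M> \<A> m"
    by (simp add: regular_above_def assms(7) regular_mono_subobjects_of)
  \<comment> \<open>The choice operator picks the same meet for the same class, so the closures even coincide.\<close>
  then have "regular_closure C \<M> \<B> m = regular_closure C \<M> \<A> m"
    by (simp add: regular_closure_def)
  moreover have "regular_closure C \<M> \<A> m \<in> M_over C \<M> (Cod C m)"
    using regular_closure_meet[OF m] by (simp add: M_meet_def)
  moreover from this have "regular_closure C \<M> \<A> m \<in> Arr C"
    using M_arr by (auto simp: M_over_def)
  ultimately show
    "M_equiv C \<M> (Cod C m) (regular_closure C \<M> \<A> m) (regular_closure C \<M> \<B> m)"
    by (simp add: M_equiv_def M_le_refl)
qed

end
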